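(* Let $n\ge 2$, let $N,i,j,k_1,\dots,k_n$ be positive integers with $\gcd(N,i,j,k_1,\dots,k_n)=1$ and $N\nmid i+j+k_1+\cdots+k_n$. Let $p\equiv 1\pmod N$ be a prime, let $\lambda_1,\dots,\lambda_n\in\mathbb{F}_p$ be distinct and different from $0$ and $1$, and let $\eta_N\in\widehat{\mathbb{F}_p^\times}$ be a primitive character of order $N$ (exact order $N$). Let $C_{\lambda}^{[N;i,j,\mathbf{k}]}$ be the generalized Picard curve $$y^N=x^i(1-x)^j(1-\lambda_1x)^{k_1}\cdots(1-\lambda_nx)^{k_n}.$$ Then $$\#C_{\lambda}^{[N;i,j,\mathbf{k}]}(\mathbb{F}_p)=1+p+\sum_{m=1}^{N-1}\mathbb{P}_D^{(n)}\left[\begin{matrix}\eta_N^{mi}; & \eta_N^{-mk_1}\ \cdots\ \eta_N^{-mk_n}\\ & \eta_N^{mi+mj}\end{matrix};\,\lambda_1,\dots,\lambda_n\right].$$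
   Context: $\#C_{\lambda}^{[N;i,j,\mathbf{k}]}(\mathbb{F}_p)$ denotes the number of $\mathbb{F}_p$-points of the (singular) curve, i.e. the number of affine solutions $(x,y)\in\mathbb{F}_p^2$ of the equation plus $1$ for the single point at infinity. $\widehat{\mathbb{F}_p^\times}$ is the group of complex-valued multiplicative characters of $\mathbb{F}_p^\times$; every character $\chi$, including the trivial one, is extended to $\mathbb{F}_p$ by $\chi(0)=0$, and $\overline{\chi}=\chi^{-1}$. For $A,C,B_1,\dots,B_n\in\widehat{\mathbb{F}_p^\times}$ and $\lambda_1,\dots,\lambda_n\in\mathbb{F}_p$, the finite-field Appell-Lauricella period function is $$\mathbb{P}_D^{(n)}\left[\begin{matrix}A; & B_1\ \cdots\ B_n\\ & C\end{matrix};\lambda_1,\dots,\lambda_n\right]=\sum_{y\in\mathbb{F}_p}A(y)\,C\overline{A}(1-y)\,\overline{B_1}(1-\lambda_1y)\cdots\overline{B_n}(1-\lambda_ny).$$ *)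

theory Defs
  imports
    Complex_Main
    "HOL-Algebra.Multiplicative_Group"
    "HOL-Number_Theory.Cong"
    "Berlekamp_Zassenhaus.Finite_Field"
begin

text \<open>
  The group of multiplicative characters of a field. A character is carried by its extension to
  the whole field, with value \<open>0\<close> at \<open>0\<close>; this convention also applies to the trivial character.
  Nonvanishing on units and multiplicativity force the value \<open>1\<close> at \<open>1\<close>.
\<close>

definition char_group :: "('a::field \<Rightarrow> complex) monoid" where
  "char_group =
    \<lparr>carrier = {\<chi>. \<chi> 0 = 0 \<and> (\<forall>x. x \<noteq> 0 \<longrightarrow> \<chi> x \<noteq> 0) \<and>
                   (\<forall>x y. x \<noteq> 0 \<longrightarrow> y \<noteq> 0 \<longrightarrow> \<chi> (x * y) = \<chi> x * \<chi> y)},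
     monoid.mult = (\<lambda>\<chi> \<psi> x. \<chi> x * \<psi> x),
     one = (\<lambda>x. if x = 0 then 0 else 1)\<rparr>"

lemma comm_group_char_group: "comm_group (char_group :: ('a::field \<Rightarrow> complex) monoid)"
proof (rule comm_groupI)
  fix \<chi> :: "'a \<Rightarrow> complex"
  assume "\<chi> \<in> carrier char_group"
  then show "\<exists>\<psi>\<in>carrier char_group. \<psi> \<otimes>\<^bsub>char_group\<^esub> \<chi> = \<one>\<^bsub>char_group\<^esub>"
    by (intro bexI[of _ "\<lambda>x. inverse (\<chi> x)"]) (auto simp: char_group_def fun_eq_iff)
qed (auto simp: char_group_def fun_eq_iff algebra_simps)

text \<open>
  The Appell-Lauricella period function. The characters \<open>B r\<close> and the arguments \<open>lam r\<close> are
  indexed by \<open>r = 1, \<dots>, n\<close>; other values of \<open>B\<close> and \<open>lam\<close> are irrelevant.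
\<close>

definition period_D ::
    "nat \<Rightarrow> ('a::{field,finite} \<Rightarrow> complex) \<Rightarrow> (nat \<Rightarrow> 'a \<Rightarrow> complex) \<Rightarrow> ('a \<Rightarrow> complex) \<Rightarrow>
     (nat \<Rightarrow> 'a) \<Rightarrow> complex" where
  "period_D n A B C lam =
    (\<Sum>y\<in>UNIV. A y * (C \<otimes>\<^bsub>char_group\<^esub> inv\<^bsub>char_group\<^esub> A) (1 - y) *
       (\<Prod>r=1..n. (inv\<^bsub>char_group\<^esub> (B r)) (1 - lam r * y)))"

definition picard_affine_points ::
    "nat \<Rightarrow> nat \<Rightarrow> nat \<Rightarrow> nat \<Rightarrow> (nat \<Rightarrow> nat) \<Rightarrow> (nat \<Rightarrow> 'a::field) \<Rightarrow> ('a \<times> 'a) set" where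
  "picard_affine_points n N i j k lam =
    {(x, y). y ^ N = x ^ i * (1 - x) ^ j * (\<Prod>r=1..n. (1 - lam r * x) ^ k r)}"

text \<open>
  Points of the singular curve: the affine solutions and a single point at infinity.
\<close>

definition picard_num_points ::
    "nat \<Rightarrow> nat \<Rightarrow> nat \<Rightarrow> nat \<Rightarrow> (nat \<Rightarrow> nat) \<Rightarrow> (nat \<Rightarrow> 'a::{field,finite}) \<Rightarrow> nat" where
  "picard_num_points n N i j k lam = card (picard_affine_points n N i j k lam) + 1"

end

theory Submission
  imports Defs
begin

text \<open>
  For \<open>c \<noteq> 0\<close> let \<open>r c\<close> be the number of solutions of \<open>y ^ N = c\<close> and let
  \<open>S c = (\<Sum>m<N. \<eta> c ^ m)\<close>. Since \<open>\<eta> c ^ N = 1\<close>, the sum \<open>S c\<close> is \<open>N\<close> or \<open>0\<close> according to whether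
  \<open>\<eta> c = 1\<close>; an \<open>N\<close>-th power has \<open>\<eta> c = 1\<close>, and no equation \<open>y ^ N = c\<close> has more than \<open>N\<close> roots,
  so \<open>r c \<le> S c\<close>. Summed over all \<open>c \<noteq> 0\<close> both sides give the number of units, the right one by
  orthogonality of characters, so \<open>r = S\<close>, with no appeal to a primitive root. The theorem
  follows by summing over \<open>x\<close> and expanding each \<open>\<eta> ^ m\<close> multiplicatively.
\<close>

lemma char_group_simps:
  "\<chi> \<in> carrier char_group \<longleftrightarrow> \<chi> 0 = 0 \<and> (\<forall>x. x \<noteq> 0 \<longrightarrow> \<chi> x \<noteq> 0) \<and>
     (\<forall>x y. x \<noteq> 0 \<longrightarrow> y \<noteq> 0 \<longrightarrow> \<chi> (x * y) = \<chi> x * \<chi> y)"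
  "(\<chi> \<otimes>\<^bsub>char_group\<^esub> \<psi>) x = \<chi> x * \<psi> x"
  "\<one>\<^bsub>char_group\<^esub> x = (if x = 0 then 0 else 1)"
  by (simp_all add: char_group_def)

interpretation char_group: comm_group "char_group :: ('a::field \<Rightarrow> complex) monoid"
  by (rule comm_group_char_group)

context
  fixes \<chi> :: "'a::field \<Rightarrow> complex"
  assumes \<chi>: "\<chi> \<in> carrier char_group"
begin

lemma char_mult: "\<chi> (x * y) = \<chi> x * \<chi> y"
  using \<chi> by (cases "x = 0 \<or> y = 0") (auto simp: char_group_simps)

lemma char_0: "\<chi> 0 = 0"
  using \<chi> by (simp add: char_group_simps)

lemma char_nonzero: "x \<noteq> 0 \<Longrightarrow> \<chi> x \<noteq> 0"
  using \<chi> by (simp add: char_group_simps)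

lemma char_1: "\<chi> 1 = 1"
  using char_mult[of 1 1] char_nonzero[of 1] by simp

lemma char_power: "\<chi> (x ^ m) = \<chi> x ^ m"
  by (induction m) (simp_all add: char_1 char_mult)

lemma char_prod: "\<chi> (prod f A) = (\<Prod>r\<in>A. \<chi> (f r))"
  by (induction A rule: infinite_finite_induct) (simp_all add: char_1 char_mult)

text \<open>The case split matters for \<open>m = 0\<close>: the trivial character vanishes at
  \<open>0\<close>, while \<open>0 ^ 0 = 1\<close>.\<close>

lemma char_pow_apply:
  "(\<chi> [^]\<^bsub>char_group\<^esub> (m::nat)) x = (if x = 0 then 0 else \<chi> x ^ m)"
  by (induction m) (auto simp: char_group_simps char_0)

end

text \<open>Orthogonality: translation by a unit where the character is not \<open>1\<close> rescales the sum.\<close>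

lemma sum_nontrivial_char:
  fixes \<chi> :: "'a::{field,finite} \<Rightarrow> complex"
  assumes \<chi>: "\<chi> \<in> carrier char_group" and nontriv: "\<chi> \<noteq> \<one>\<^bsub>char_group\<^esub>"
  shows "(\<Sum>x\<in>-{0}. \<chi> x) = 0"
proof -
  obtain a where a: "\<chi> a \<noteq> \<one>\<^bsub>char_group\<^esub> a"
    using nontriv by blast
  \<comment> \<open>Both characters vanish at \<open>0\<close>, so they can only differ at a
    unit.\<close>
  then have a0: "a \<noteq> 0" and a1: "\<chi> a \<noteq> 1"
    using char_0[OF \<chi>] by (auto simp: char_group_simps split: if_splits)
  have "(\<Sum>x\<in>-{0}. \<chi> x) = (\<Sum>x\<in>-{0}. \<chi> (a * x))"
    by (rule sum.reindex_bij_witness[of _ "\<lambda>x. a * x" "\<lambda>x. x / a"]) (use a0 in auto)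
  also have "\<dots> = \<chi> a * (\<Sum>x\<in>-{0}. \<chi> x)"
    by (simp add: char_mult[OF \<chi>] sum_distrib_left)
  finally show ?thesis
    using a1 by simp
qed

text \<open>The solutions are the roots of \<open>?q\<close>. As \<open>N > 0\<close>, the constant
  \<open>c\<close> leaves the coefficient at \<open>N\<close> equal to 1, so \<open>?q\<close> is
  nonzero.\<close>

lemma card_nth_roots_le:
  fixes c :: "'a::idom"
  assumes "N > 0"
  shows "card {y. y ^ N = c} \<le> N"
proof -
  let ?q = "monom 1 N - [:c:]"
  have "coeff ?q N = 1"
    using assms by (simp add: coeff_pCons split: nat.splits)
  then have "?q \<noteq> 0"
    by (metis coeff_0 zero_neq_one)
  moreover have "degree ?q \<le> N"
    by (intro degree_diff_le) (simp_all add: degree_monom_le)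
  ultimately have "card {y. poly ?q y = 0} \<le> N"
    using card_poly_roots_bound[of ?q] by linarith
  then show ?thesis
    by (simp add: poly_monom)
qed

lemma card_nth_roots_eq_char_sum:
  fixes \<eta> :: "'a::{field,finite} \<Rightarrow> complex"
  assumes N: "N > 0" and \<eta>: "\<eta> \<in> carrier char_group" and ord: "group.ord char_group \<eta> = N"
    and c: "c \<noteq> 0"
  shows "of_nat (card {y. y ^ N = c}) = (\<Sum>m<N. \<eta> c ^ m)"
proof -
  let ?U = "-{0::'a}"
  define r where "r c = card {y. y ^ N = c}" for c :: 'a
  \<comment> \<open>The value of the character sum as a natural number, so that it can be compared
    with \<open>r\<close> by an inequality.\<close>
  define s where "s c = (if \<eta> c = 1 then N else 0)" for c
  have root_of_unity: "\<eta> x ^ N = 1" if "x \<noteq> 0" for x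
    using char_group.pow_ord_eq_1[OF \<eta>] char_pow_apply[OF \<eta>, of N x] that ord
    by (simp add: char_group_simps)
  have s: "of_nat (s x) = (\<Sum>m<N. \<eta> x ^ m)" if "x \<noteq> 0" for x
    using root_of_unity[OF that] by (simp add: s_def geometric_sum)
  have le: "r x \<le> s x" if "x \<noteq> 0" for x
  proof (cases "\<eta> x = 1")
    case True
    then show ?thesis
      using card_nth_roots_le[OF N] by (simp add: r_def s_def)
  next
    case False
    have "y ^ N \<noteq> x" for y
    proof
      assume y: "y ^ N = x"
      then have "y \<noteq> 0"
        using that N by auto
      then show False
        using root_of_unity[of y] char_power[OF \<eta>, of y N] y False by simp
    qed
    then show ?thesis
      by (simp add: r_def)
  qed
  \<comment> \<open>The fibres of the power map partition the units.\<close>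
  have "(\<Sum>x\<in>?U. r x) = card (\<Union>x\<in>?U. {y. y ^ N = x})"
    unfolding r_def by (rule card_UN_disjoint[symmetric]) auto
  also have "(\<Union>x\<in>?U. {y. y ^ N = x}) = ?U"
    using N by auto
  finally have sum_r: "(\<Sum>x\<in>?U. r x) = card ?U" .
  have "of_nat (\<Sum>x\<in>?U. s x) = (\<Sum>x\<in>?U. \<Sum>m<N. \<eta> x ^ m)"
    by (simp add: s)
  also have "\<dots> = (\<Sum>m<N. \<Sum>x\<in>?U. \<eta> x ^ m)"
    by (rule sum.swap)
  also have "\<dots> = (\<Sum>m<N. if m = 0 then of_nat (card ?U) else 0)"
  proof (rule sum.cong[OF refl])
    fix m assume m: "m \<in> {..<N}"
    have "(\<Sum>x\<in>?U. \<eta> x ^ m) = 0" if "m \<noteq> 0"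
    proof -
      \<comment> \<open>Here the exact order enters: for \<open>0 < m < N\<close> the power of
        \<open>\<eta>\<close> is a nontrivial character, so orthogonality applies.\<close>
      have "\<not> N dvd m"
        using that m by (auto dest: dvd_imp_le)
      then have "\<eta> [^]\<^bsub>char_group\<^esub> m \<noteq> \<one>\<^bsub>char_group\<^esub>"
        using char_group.pow_eq_id[OF \<eta>] ord by simp
      then have "(\<Sum>x\<in>?U. (\<eta> [^]\<^bsub>char_group\<^esub> m) x) = 0"
        by (intro sum_nontrivial_char char_group.nat_pow_closed \<eta>)
      then show ?thesis
        by (simp add: char_pow_apply[OF \<eta>])
    qed
    then show "(\<Sum>x\<in>?U. \<eta> x ^ m) = (if m = 0 then of_nat (card ?U) else 0)"
      by simp
  qed
  also have "\<dots> = of_nat (card ?U)"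
    using N by simp
  finally have sum_s: "(\<Sum>x\<in>?U. s x) = card ?U"
    by (simp only: of_nat_eq_iff)
  have "r c = s c"
  proof (rule ccontr)
    assume "r c \<noteq> s c"
    \<comment> \<open>With \<open>r \<le> s\<close> everywhere on the units, a strict inequality at
      \<open>c\<close> alone would separate the two totals.\<close>
    then have "(\<Sum>x\<in>?U. r x) < (\<Sum>x\<in>?U. s x)"
      using le c by (intro sum_strict_mono_ex1) (auto simp: le_less)
    then show False
      using sum_r sum_s by simp
  qed
  then show ?thesis
    using s[OF c] by (simp add: r_def)
qed

text \<open>
  Dropping the term \<open>m = 0\<close> makes the formula uniform: at \<open>c = 0\<close> all terms of the sum vanish.
\<close>

corollary card_nth_roots:
  fixes \<eta> :: "'a::{field,finite} \<Rightarrow> complex"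
  assumes N: "N > 0" and \<eta>: "\<eta> \<in> carrier char_group" and "group.ord char_group \<eta> = N"
  shows "of_nat (card {y. y ^ N = c}) = 1 + (\<Sum>m=1..N-1. \<eta> c ^ m)"
proof (cases "c = 0")
  case True
  then have "{y. y ^ N = c} = {0}"
    using N by auto
  moreover have "(\<Sum>m=1..N-1. (0::complex) ^ m) = 0"
    by (rule sum.neutral) auto
  ultimately show ?thesis
    using True by (simp add: char_0[OF \<eta>])
next
  case False
  have "{..<N} = insert 0 {1..N-1}"
    using N by auto
  then show ?thesis
    using card_nth_roots_eq_char_sum[OF assms False] by simp
qed

text \<open>The inverses in the definition of \<open>period_D\<close> turn all its factors into
  positive powers of \<open>\<eta>\<close>, which multiply together. Positivity of the exponents
  makes this valid also where a factor vanishes.\<close>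

lemma period_D_char_powers:
  fixes \<eta> :: "'a::{field,finite} \<Rightarrow> complex"
  assumes \<eta>: "\<eta> \<in> carrier char_group"
    and pos: "m > 0" "i > 0" "j > 0" "\<forall>r\<in>{1..n}. k r > 0"
  shows "period_D n
      (\<eta> [^]\<^bsub>char_group\<^esub> (m * i))
      (\<lambda>r. \<eta> [^]\<^bsub>char_group\<^esub> (- int (m * k r)))
      (\<eta> [^]\<^bsub>char_group\<^esub> (m * i + m * j)) lam =
    (\<Sum>x\<in>UNIV. \<eta> (x ^ i * (1 - x) ^ j * (\<Prod>r=1..n. (1 - lam r * x) ^ k r)) ^ m)"
proof -
  have quot: "\<eta> [^]\<^bsub>char_group\<^esub> (m * i + m * j) \<otimes>\<^bsub>char_group\<^esub>
      inv\<^bsub>char_group\<^esub> (\<eta> [^]\<^bsub>char_group\<^esub> (m * i)) = \<eta> [^]\<^bsub>char_group\<^esub> (m * j)"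
  proof -
    have "\<eta> [^]\<^bsub>char_group\<^esub> (m * i + m * j) =
        \<eta> [^]\<^bsub>char_group\<^esub> (m * j) \<otimes>\<^bsub>char_group\<^esub> \<eta> [^]\<^bsub>char_group\<^esub> (m * i)"
      using \<eta> by (simp add: char_group.nat_pow_mult add.commute)
    then show ?thesis
      using \<eta> by (simp add: char_group.m_assoc)
  qed
  have inv_neg: "inv\<^bsub>char_group\<^esub> (\<eta> [^]\<^bsub>char_group\<^esub> (- int t)) = \<eta> [^]\<^bsub>char_group\<^esub> t" for t
    using \<eta> by (simp add: char_group.int_pow_neg_int)
  \<comment> \<open>For \<open>t > 0\<close> both sides are \<open>0\<close> at
    \<open>x = 0\<close>, so the case split disappears.\<close>
  have pow: "(\<eta> [^]\<^bsub>char_group\<^esub> t) x = \<eta> x ^ t" if "t > 0" for t :: nat and x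
    using that by (simp add: char_pow_apply[OF \<eta>] char_0[OF \<eta>])
  show ?thesis
    unfolding period_D_def quot inv_neg using pos
    by (intro sum.cong refl)
      (simp add: pow char_mult[OF \<eta>] char_power[OF \<eta>] char_prod[OF \<eta>] power_mult_distrib
        prod_power_distrib flip: power_mult, simp add: mult.commute)
qed

theorem theorem5p3:
  fixes n N i j p :: nat
    and k :: "nat \<Rightarrow> nat"
    and lam :: "nat \<Rightarrow> 'p::prime_card mod_ring"
    and \<eta> :: "'p mod_ring \<Rightarrow> complex"
  assumes "n \<ge> 2"
    and "N > 0" and "i > 0" and "j > 0" and "\<forall>r\<in>{1..n}. k r > 0"
    and "Gcd ({N, i, j} \<union> k ` {1..n}) = 1"
    and "\<not> N dvd i + j + (\<Sum>r=1..n. k r)"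
    and "p = CARD('p)"
    and "[p = 1] (mod N)"
    and "inj_on lam {1..n}"
    and "\<forall>r\<in>{1..n}. lam r \<noteq> 0 \<and> lam r \<noteq> 1"
    and "\<eta> \<in> carrier char_group"
    and "group.ord char_group \<eta> = N"
  shows "of_nat (picard_num_points n N i j k lam) =
    1 + of_nat p +
    (\<Sum>m=1..N-1. period_D n
       (\<eta> [^]\<^bsub>char_group\<^esub> (m * i))
       (\<lambda>r. \<eta> [^]\<^bsub>char_group\<^esub> (- int (m * k r)))
       (\<eta> [^]\<^bsub>char_group\<^esub> (m * i + m * j))
       lam)"
proof -
  let ?f = "\<lambda>x. x ^ i * (1 - x) ^ j * (\<Prod>r=1..n. (1 - lam r * x) ^ k r)"
  \<comment> \<open>Affine points are counted fibrewise over \<open>x\<close>; the constant term 1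
    of each fibre count later adds up to \<open>p\<close>.\<close>
  have "picard_affine_points n N i j k lam = (SIGMA x:UNIV. {y. y ^ N = ?f x})"
    by (auto simp: picard_affine_points_def)
  then have "card (picard_affine_points n N i j k lam) = (\<Sum>x\<in>UNIV. card {y. y ^ N = ?f x})"
    by simp
  then have "of_nat (picard_num_points n N i j k lam) =
      1 + (\<Sum>x\<in>UNIV. of_nat (card {y. y ^ N = ?f x}) :: complex)"
    by (simp add: picard_num_points_def)
  also have "\<dots> = 1 + (\<Sum>x\<in>UNIV. 1 + (\<Sum>m=1..N-1. \<eta> (?f x) ^ m))"
    by (simp only: card_nth_roots[OF assms(2,12,13)])
  also have "\<dots> = 1 + of_nat p + (\<Sum>m=1..N-1. \<Sum>x\<in>UNIV. \<eta> (?f x) ^ m)"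
    using assms(8) sum.swap[of "\<lambda>x m. \<eta> (?f x) ^ m" "{1..N-1}" UNIV]
    by (simp add: sum.distrib)
  also have "(\<Sum>m=1..N-1. \<Sum>x\<in>UNIV. \<eta> (?f x) ^ m) =
      (\<Sum>m=1..N-1. period_D n
         (\<eta> [^]\<^bsub>char_group\<^esub> (m * i))
         (\<lambda>r. \<eta> [^]\<^bsub>char_group\<^esub> (- int (m * k r)))
         (\<eta> [^]\<^bsub>char_group\<^esub> (m * i + m * j)) lam)"
    using assms(3-5,12) by (intro sum.cong refl period_D_char_powers[symmetric]) auto
  finally show ?thesis .
qed

end
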